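(* Let $P=\{010,110\}$. Let $\mathfrak a_{n,m,f}$ be the number of $\sigma\in\mathcal{I}_n(010,110)$ with $\max(\sigma)=m$ and $|\mathbf{Forb}(\sigma,P)|=f$. Let $\mathfrak b_{n,k,f}$ be the number of words $\omega$ of length $n$ over $\{0,\dots,k-1\}$ avoiding $010$ and $110$ with $|\mathbf{Forb}(\omega,P)|=f$. Let $\mathfrak c_{n,k}$ be the number of words of length $\ell$ over $\{0,\dots,k-1\}$ avoiding $010$ and $110$, summed over $\ell\in\{0,\dots,n\}$ (so $\mathfrak c_{-1,k}=0$). Then for all integers $2\leqslant f\leqslant m+1\leqslant n$, $$\mathfrak a_{n,m,f}=\sum_{p=m+1}^{n}\sum_{i=0}^{f-1}\sum_{j=0}^{m-1}\mathfrak a_{p-1,j,i}\Big(\mathfrak b_{n-p,m-i,f-i-1}+\delta_{f,m+1}\,\mathfrak c_{n-p-1,m-i}\Big),$$ where $\delta$ is the Kronecker delta.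
   Context: For $n\in\mathbb N$, an inversion sequence of size $n$ is a sequence $\sigma=(\sigma_1,\dots,\sigma_n)\in\mathbb N^n$ with $\sigma_i<i$ for all $i$. An integer sequence contains a pattern $\rho$ (a finite integer sequence such as $010$ or $110$) if it has a subsequence order-isomorphic to $\rho$, and avoids $\rho$ otherwise. $\mathcal{I}_n(P)$ denotes the set of inversion sequences of size $n$ avoiding every pattern in $P$. $\max(\sigma)$ is the largest entry of $\sigma$ ($-1$ for the empty sequence). For an integer sequence (or word) $\alpha$ avoiding the patterns in a set $P$, a value $v\in\{0,\dots,\max(\alpha)\}$ is forbidden by $\alpha$ and $P$ if the sequence $\alpha\cdot(M,v)$ (i.e. $\alpha$ followed by an entry $M$ and then an entry $v$) contains a pattern of $P$ whenever $M>\max(\alpha)$; $\mathbf{Forb}(\alpha,P)$ is the set of such forbidden values. *)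

theory Defs
  imports Main "HOL-Library.Sublist"
begin

definition order_isomorphic :: "nat list \<Rightarrow> nat list \<Rightarrow> bool" where
  "order_isomorphic xs ys \<longleftrightarrow>
     length xs = length ys \<and>
     (\<forall>i<length xs. \<forall>j<length xs. xs ! i < xs ! j \<longleftrightarrow> ys ! i < ys ! j)"

definition contains :: "nat list \<Rightarrow> nat list \<Rightarrow> bool" where
  "contains \<sigma> \<rho> \<longleftrightarrow> (\<exists>\<tau>. subseq \<tau> \<sigma> \<and> order_isomorphic \<tau> \<rho>)"

definition avoids_all :: "nat list \<Rightarrow> nat list set \<Rightarrow> bool" where
  "avoids_all \<sigma> P \<longleftrightarrow> (\<forall>\<rho>\<in>P. \<not> contains \<sigma> \<rho>)"

(* Lists are indexed from 0, so the bound "\<sigma>_i < i" for 1 \<le> i \<le> n is shifted by one. *)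
definition inversion_seq :: "nat list \<Rightarrow> bool" where
  "inversion_seq \<sigma> \<longleftrightarrow> (\<forall>i<length \<sigma>. \<sigma> ! i < i + 1)"

definition inv_seqs_avoiding :: "nat \<Rightarrow> nat list set \<Rightarrow> nat list set" where
  "inv_seqs_avoiding n P = {\<sigma>. length \<sigma> = n \<and> inversion_seq \<sigma> \<and> avoids_all \<sigma> P}"

definition words_avoiding :: "nat \<Rightarrow> nat \<Rightarrow> nat list set \<Rightarrow> nat list set" where
  "words_avoiding n k P = {\<omega>. length \<omega> = n \<and> set \<omega> \<subseteq> {0..<k} \<and> avoids_all \<omega> P}"

(* Integer-valued because the maximum of the empty sequence is -1. *)
definition max_entry :: "nat list \<Rightarrow> int" where
  "max_entry \<sigma> = (if \<sigma> = [] then -1 else int (Max (set \<sigma>)))"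

(* Since max_entry \<alpha> \<ge> -1, every integer M > max_entry \<alpha> is a natural number. *)
definition Forb :: "nat list \<Rightarrow> nat list set \<Rightarrow> nat set" where
  "Forb \<alpha> P =
     {v. int v \<le> max_entry \<alpha> \<and>
         (\<forall>M. int M > max_entry \<alpha> \<longrightarrow> (\<exists>\<rho>\<in>P. contains (\<alpha> @ [M, v]) \<rho>))}"

definition pats :: "nat list set" where
  "pats = {[0, 1, 0], [1, 1, 0]}"

definition num_a :: "nat \<Rightarrow> nat \<Rightarrow> nat \<Rightarrow> nat" where
  "num_a n m f =
     card {\<sigma> \<in> inv_seqs_avoiding n pats. max_entry \<sigma> = int m \<and> card (Forb \<sigma> pats) = f}"

definition num_b :: "nat \<Rightarrow> nat \<Rightarrow> nat \<Rightarrow> nat" where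
  "num_b n k f = card {\<omega> \<in> words_avoiding n k pats. card (Forb \<omega> pats) = f}"

(* The first argument is an integer so that num_c (-1) k = 0 is the empty sum. *)
definition num_c :: "int \<Rightarrow> nat \<Rightarrow> nat" where
  "num_c n k = (\<Sum>l\<in>{0..n}. card (words_avoiding (nat l) k pats))"

end

(* Cut \<sigma> at the first occurrence (position p) of its maximum m: \<sigma> = \<alpha> m \<beta>. Avoiding 110 forces
   \<beta> = \<gamma> m^t with all entries of \<gamma> below m, and \<sigma> avoids the patterns iff \<alpha> and \<gamma> do and no
   entry of \<gamma> is forbidden by \<alpha>. If t = 0, the forbidden values of \<sigma> are those of \<alpha>, those of
   \<gamma>, and m; if t > 0, every value up to m is forbidden, which gives the \<delta> term. An increasing
   relabelling of the m - i values still allowed after \<alpha> turns \<gamma> into a word over {0..<m - i}. *)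
theory Submission
  imports Defs "HOL-Library.Infinite_Set"
begin

section \<open>Subsequences of length two and three\<close>

lemma subseq_pair_mem:
  assumes "subseq [a, b] xs"
  shows "a \<in> set xs" "b \<in> set xs"
proof -
  have "subseq [a] [a, b]" "subseq [b] [a, b]" by simp_all
  with assms have "subseq [a] xs" "subseq [b] xs" by (blast intro: subseq_order.order_trans)+
  then show "a \<in> set xs" "b \<in> set xs" by (simp_all add: subseq_singleton_left)
qed

lemma subseq_pair_append:
  "subseq [a, b] (xs @ ys) \<longleftrightarrow>
    subseq [a, b] xs \<or> (a \<in> set xs \<and> b \<in> set ys) \<or> subseq [a, b] ys"
proof (induction xs)
  case Nil
  then show ?case by simp
next
  case (Cons x xs)
  have "b \<in> set ys" if "subseq [a, b] ys"
    using that by (rule subseq_pair_mem)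
  with Cons show ?case by (auto simp: subseq_singleton_left)
qed

lemma subseq_triple_snoc:
  "subseq [a, b, c] (xs @ [x]) \<longleftrightarrow> subseq [a, b, c] xs \<or> (c = x \<and> subseq [a, b] xs)"
proof (induction xs)
  case Nil
  then show ?case by (auto dest: list_emb_length)
next
  case (Cons y xs)
  then show ?case by (auto simp: subseq_pair_append subseq_singleton_left)
qed

text \<open>Both lists lie over \<open>K\<close>, where \<open>inv_into K e\<close> undoes
  \<open>e\<close>, so an embedding can be pulled back.\<close>

lemma subseq_map_inj_on:
  assumes "inj_on e K" "set xs \<subseteq> K" "set ys \<subseteq> K"
  shows "subseq (map e xs) (map e ys) \<longleftrightarrow> subseq xs ys"
proof
  assume "subseq (map e xs) (map e ys)"
  then have "subseq (map (inv_into K e) (map e xs)) (map (inv_into K e) (map e ys))"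
    by (rule subseq_map)
  moreover have "map (inv_into K e) (map e zs) = zs" if "set zs \<subseteq> K" for zs
    using that assms(1) by (auto intro!: map_idI)
  ultimately show "subseq xs ys" using assms by simp
qed (rule subseq_map)

section \<open>Avoidance of 010 and 110, and the values they forbid\<close>

lemma order_isomorphic_pats:
  "order_isomorphic \<tau> [0, 1, 0] \<longleftrightarrow> (\<exists>a b. a < b \<and> \<tau> = [a, b, a])" (is ?th1)
  "order_isomorphic \<tau> [1, 1, 0] \<longleftrightarrow> (\<exists>a b. a < b \<and> \<tau> = [b, b, a])" (is ?th2)
proof -
  have all3: "(\<forall>i<Suc (Suc (Suc 0)). Q i) \<longleftrightarrow> Q 0 \<and> Q 1 \<and> Q 2" for Q
    by (auto simp: less_Suc_eq numeral_2_eq_2)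
  have triple: "\<exists>x y z. \<tau> = [x, y, z]" if "order_isomorphic \<tau> [a, b, c]" for a b c
    using that by (auto simp: order_isomorphic_def length_Suc_conv)
  have iso: "order_isomorphic [x, y, z] [0, 1, 0] \<longleftrightarrow> x < y \<and> x = z"
    "order_isomorphic [x, y, z] [1, 1, 0] \<longleftrightarrow> z < y \<and> x = y" for x y z
    unfolding order_isomorphic_def by (auto simp: all3)
  show ?th1 ?th2 using triple iso by (metis, metis)
qed

lemma avoids_pats_iff:
  "avoids_all xs pats \<longleftrightarrow>
    (\<forall>a b. a < b \<longrightarrow> \<not> subseq [a, b, a] xs \<and> \<not> subseq [b, b, a] xs)"
proof -
  have "avoids_all xs pats \<longleftrightarrow>
      (\<forall>\<tau>. subseq \<tau> xs \<longrightarrow> \<not> order_isomorphic \<tau> [0, 1, 0] \<and> \<not> order_isomorphic \<tau> [1, 1, 0])"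
    unfolding avoids_all_def contains_def pats_def by blast
  then show ?thesis unfolding order_isomorphic_pats by blast
qed

lemma avoids_pats_Nil [simp]: "avoids_all [] pats"
  by (simp add: avoids_pats_iff)

text \<open>A new occurrence must use the appended entry as its last letter, which is the low letter
  of either pattern. Only pairs in the prefix remain to be checked, which suits induction from the
  right.\<close>

lemma avoids_pats_snoc:
  "avoids_all (xs @ [x]) pats \<longleftrightarrow>
    avoids_all xs pats \<and> (\<forall>b>x. \<not> subseq [x, b] xs \<and> \<not> subseq [b, b] xs)"
  unfolding avoids_pats_iff subseq_triple_snoc by blast

lemma avoids_pats_map:
  assumes mono: "strict_mono_on K h" and K: "set xs \<subseteq> K"
  shows "avoids_all (map h xs) pats \<longleftrightarrow> avoids_all (xs :: nat list) pats"
  using K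
proof (induction xs rule: rev_induct)
  case Nil
  then show ?case by simp
next
  case (snoc x xs)
  have inj: "inj_on h K"
    using mono by (rule strict_mono_on_imp_inj_on)
  have pair: "subseq [h c, h d] (map h xs) \<longleftrightarrow> subseq [c, d] xs" if "c \<in> K" "d \<in> K" for c d
    using subseq_map_inj_on[OF inj, of "[c, d]" xs] that snoc.prems by simp
  note mem = subseq_pair_mem
  have less: "h c < h d \<longleftrightarrow> c < d" if "c \<in> K" "d \<in> K" for c d
    using strict_mono_on_less[OF mono that] .
  \<comment> \<open>The bound variable ranges over all naturals, not only over \<open>K\<close> or
    its image under \<open>h\<close>. A value outside these cannot occur in the list in question, so
    it meets the condition trivially.\<close>
  have "(\<forall>b>h x. \<not> subseq [h x, b] (map h xs) \<and> \<not> subseq [b, b] (map h xs)) \<longleftrightarrow>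
      (\<forall>b>x. \<not> subseq [x, b] xs \<and> \<not> subseq [b, b] xs)" (is "?L \<longleftrightarrow> ?R")
  proof
    assume ?L
    show ?R
    proof (intro allI impI)
      fix b assume "x < b"
      show "\<not> subseq [x, b] xs \<and> \<not> subseq [b, b] xs"
      proof (cases "b \<in> K")
        case True
        with less[of x b] \<open>x < b\<close> snoc.prems have "h x < h b" by simp
        with \<open>?L\<close> have "\<not> subseq [h x, h b] (map h xs)" "\<not> subseq [h b, h b] (map h xs)"
          by blast+
        then show ?thesis using pair[of x b] pair[of b b] True snoc.prems by simp
      next
        case False
        with snoc.prems have "b \<notin> set xs" by auto
        then show ?thesis by (blast dest: mem)
      qed
    qed
  next
    assume ?R
    show ?L
    proof (intro allI impI)
      fix b assume "h x < b"
      show "\<not> subseq [h x, b] (map h xs) \<and> \<not> subseq [b, b] (map h xs)"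
      proof (cases "b \<in> h ` K")
        case True
        then obtain c where "b = h c" "c \<in> K" by blast
        with less[of x c] \<open>h x < b\<close> snoc.prems have "x < c" by simp
        with \<open>?R\<close> have "\<not> subseq [x, c] xs" "\<not> subseq [c, c] xs" by blast+
        then show ?thesis using pair[of x c] pair[of c c] \<open>b = h c\<close> \<open>c \<in> K\<close> snoc.prems by simp
      next
        case False
        with snoc.prems have "b \<notin> set (map h xs)" by auto
        then show ?thesis by (blast dest: mem)
      qed
    qed
  qed
  with snoc show ?case by (simp add: avoids_pats_snoc)
qed

text \<open>For an avoiding sequence the entry \<open>M\<close> in the definition of \<open>Forb\<close> can be eliminated:
  a value is forbidden by 010 iff it occurs, and by 110 iff a larger value occurs twice.\<close>

lemma Forb_pats:
  assumes "avoids_all xs pats"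
  shows "Forb xs pats = {v. v \<in> set xs \<or> (\<exists>b>v. subseq [b, b] xs)}"
proof (cases "xs = []")
  case True
  then show ?thesis by (simp add: Forb_def max_entry_def)
next
  case False
  note mem = subseq_pair_mem
  have le: "x \<le> Max (set xs)" if "x \<in> set xs" for x
    using that by simp
  \<comment> \<open>Being larger than all entries, \<open>M\<close> completes no occurrence and is
    not repeated. Its only effect is to serve as the peak of a 010 whose outer value
    \<open>v\<close> occurs in \<open>xs\<close>.\<close>
  have step: "avoids_all (xs @ [M, v]) pats \<longleftrightarrow> v \<notin> set xs \<and> (\<forall>b>v. \<not> subseq [b, b] xs)"
    if M: "Max (set xs) < M" and v: "v \<le> Max (set xs)" for M v
  proof -
    have notin: "M \<notin> set xs" using M le by (metis leD)
    have "avoids_all (xs @ [M]) pats"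
      using assms M le[OF mem(2)] by (auto simp: avoids_pats_snoc dest!: le[OF mem(2)])
    moreover have "subseq [v, b] (xs @ [M]) \<longleftrightarrow> subseq [v, b] xs \<or> v \<in> set xs \<and> b = M" for b
      by (auto simp: subseq_pair_append dest: list_emb_length)
    moreover have "subseq [b, b] (xs @ [M]) \<longleftrightarrow> subseq [b, b] xs" for b
      using notin by (auto simp: subseq_pair_append dest: mem)
    moreover have "v \<in> set xs" if "subseq [v, b] xs" for b
      using that by (rule mem)
    moreover have "v < M" using M v by simp
    ultimately show ?thesis
      using avoids_pats_snoc[of "xs @ [M]" v] by auto
  qed
  have "v \<in> Forb xs pats \<longleftrightarrow>
      v \<le> Max (set xs) \<and> (v \<in> set xs \<or> (\<exists>b>v. subseq [b, b] xs))" for v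
  proof -
    have "v \<in> Forb xs pats \<longleftrightarrow>
        v \<le> Max (set xs) \<and> (\<forall>M>Max (set xs). \<not> avoids_all (xs @ [M, v]) pats)"
      using False by (simp add: Forb_def max_entry_def avoids_all_def)
    also have "\<dots> \<longleftrightarrow> v \<le> Max (set xs) \<and> (v \<in> set xs \<or> (\<exists>b>v. subseq [b, b] xs))"
      \<comment> \<open>\<open>lessI\<close> provides \<open>Suc (Max (set xs))\<close> as an
        admissible \<open>M\<close>, so the universal condition is not vacuous.\<close>
      using step by (metis lessI)
    finally show ?thesis .
  qed
  moreover have "v \<le> Max (set xs)" if "v \<in> set xs \<or> (\<exists>b>v. subseq [b, b] xs)" for v
    using that mem le by (meson less_le_trans less_imp_le)
  ultimately show ?thesis by blast
qed

section \<open>Decomposition at the first maximum\<close>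

text \<open>Entries of \<open>xs\<close> are forbidden by \<open>xs\<close>, so a \<open>ys\<close>
  free of forbidden values shares none with \<open>xs\<close>, and no equal pair straddles the peak.
  A further entry then completes an occurrence only inside \<open>ys\<close> or by being forbidden
  by \<open>xs\<close>, with \<open>m\<close> as the large entry.\<close>

lemma avoids_pats_peak:
  assumes "set xs \<subseteq> {..<m}" "set ys \<subseteq> {..<m}"
  shows "avoids_all (xs @ m # ys) pats \<longleftrightarrow>
    avoids_all xs pats \<and> avoids_all ys pats \<and> set ys \<inter> Forb xs pats = {}"
  using assms(2)
proof (induction ys rule: rev_induct)
  case Nil
  have "\<not> subseq [x, b] xs" if "m < b" for x b
    using that assms(1) subseq_pair_mem(2)[of x b xs] by auto
  then show ?case by (simp add: avoids_pats_snoc)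
next
  case (snoc x ys)
  have x: "x < m" and ys: "set ys \<subseteq> {..<m}" using snoc.prems by auto
  have IH: "avoids_all (xs @ m # ys) pats \<longleftrightarrow>
    avoids_all xs pats \<and> avoids_all ys pats \<and> set ys \<inter> Forb xs pats = {}"
    using snoc.IH ys by blast
  have "(\<forall>b>x. \<not> subseq [x, b] (xs @ m # ys) \<and> \<not> subseq [b, b] (xs @ m # ys)) \<longleftrightarrow>
      (\<forall>b>x. \<not> subseq [x, b] ys \<and> \<not> subseq [b, b] ys) \<and> x \<notin> Forb xs pats"
    if av: "avoids_all xs pats" "set ys \<inter> Forb xs pats = {}"
  proof -
    have disj: "b \<notin> set xs" if "b \<in> set ys" for b
      using that av Forb_pats[OF av(1)] by auto
    note mem = subseq_pair_mem
    have "subseq [x, b] (xs @ m # ys) \<longleftrightarrow> x \<in> set xs \<and> (b = m \<or> b \<in> set ys \<or> subseq [x, b] xs) \<or> subseq [x, b] ys"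
      for b using x mem(1)[of x b xs] by (auto simp: subseq_pair_append)
    moreover have "subseq [b, b] (xs @ m # ys) \<longleftrightarrow> subseq [b, b] xs \<or> subseq [b, b] ys" for b
    proof -
      have "m \<notin> set xs" "m \<notin> set ys" using assms(1) ys by auto
      then show ?thesis using disj[of b]
        by (auto simp: subseq_pair_append subseq_singleton_left dest: mem)
    qed
    ultimately show ?thesis
      unfolding Forb_pats[OF av(1)] using x by blast
  qed
  then show ?case
    using IH avoids_pats_snoc[of "xs @ m # ys" x] avoids_pats_snoc[of ys x] by auto
qed

text \<open>Both patterns end on a letter below an earlier one, so a copy of an upper bound
  completes neither.\<close>

lemma avoids_pats_append_replicate:
  assumes "set xs \<subseteq> {..m}"
  shows "avoids_all (xs @ replicate t m) pats \<longleftrightarrow> avoids_all xs pats"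
proof (induction t)
  case 0
  then show ?case by simp
next
  case (Suc t)
  have "set (xs @ replicate t m) \<subseteq> {..m}" using assms by auto
  then have "\<not> subseq [x, b] (xs @ replicate t m)" if "m < b" for x b
    using that subseq_pair_mem(2)[of x b "xs @ replicate t m"]
    by (auto simp del: set_append)
  with Suc show ?case
    using avoids_pats_snoc[of "xs @ replicate t m" m]
    by (simp add: replicate_append_same[symmetric])
qed

text \<open>Once \<open>m\<close> has recurred after the peak, any smaller entry would complete 110.
  Hence the later copies of \<open>m\<close> form a final block.\<close>

lemma avoids_pats_peak_tail:
  assumes "avoids_all (xs @ m # ys) pats" "set ys \<subseteq> {..m}"
  shows "\<exists>zs t. ys = zs @ replicate t m \<and> set zs \<subseteq> {..<m}"
  using assms
proof (induction ys rule: rev_induct)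
  case Nil
  then show ?case by simp
next
  case (snoc y ys)
  have "avoids_all (xs @ m # ys) pats"
    and y: "\<forall>b>y. \<not> subseq [b, b] (xs @ m # ys)"
    using snoc.prems avoids_pats_snoc[of "xs @ m # ys" y] by auto
  with snoc obtain zs t where zs: "ys = zs @ replicate t m" "set zs \<subseteq> {..<m}" by auto
  show ?case
  proof (cases "y = m")
    case True
    then have "ys @ [y] = zs @ replicate (Suc t) m"
      using zs by (simp add: replicate_append_same)
    with zs show ?thesis by blast
  next
    case False
    then have "y < m" using snoc.prems by auto
    with y have "m \<notin> set ys"
      by (auto simp: subseq_pair_append subseq_singleton_left)
    with zs have "t = 0" by (cases t) auto
    with zs \<open>y < m\<close> have "ys @ [y] = (zs @ [y]) @ replicate 0 m" "set (zs @ [y]) \<subseteq> {..<m}" by auto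
    then show ?thesis by blast
  qed
qed


section \<open>Forbidden values under decomposition and relabelling\<close>

lemma avoids_pats_prefix:
  "avoids_all (xs @ ys) pats \<Longrightarrow> avoids_all xs pats"
  unfolding avoids_pats_iff by (blast intro: subseq_rev_drop_many)

lemma Forb_pats_subset:
  assumes "avoids_all xs pats" "set xs \<subseteq> {..<m}"
  shows "Forb xs pats \<subseteq> {..<m}"
proof
  fix v assume "v \<in> Forb xs pats"
  then consider "v \<in> set xs" | b where "v < b" "b \<in> set xs"
    unfolding Forb_pats[OF assms(1)] by (blast dest: subseq_pair_mem)
  then show "v \<in> {..<m}" using assms(2) by cases (auto dest!: subsetD)
qed

text \<open>The two sides share no value and \<open>m\<close> occurs once, so every repeated value
  is repeated within one side.\<close>

lemma Forb_pats_peak: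
  assumes xs: "set xs \<subseteq> {..<m}" and ys: "set ys \<subseteq> {..<m}"
    and av: "avoids_all (xs @ m # ys) pats"
  shows "Forb (xs @ m # ys) pats = insert m (Forb xs pats \<union> Forb ys pats)"
proof -
  have avs: "avoids_all xs pats" "avoids_all ys pats" "set ys \<inter> Forb xs pats = {}"
    using avoids_pats_peak[OF xs ys] av by auto
  have disj: "set ys \<inter> set xs = {}"
    using avs(3) unfolding Forb_pats[OF avs(1)] by blast
  have "m \<notin> set xs" "m \<notin> set ys" using xs ys by auto
  then have "subseq [b, b] (xs @ m # ys) \<longleftrightarrow> subseq [b, b] xs \<or> subseq [b, b] ys" for b
    using disj by (auto simp: subseq_pair_append subseq_singleton_left dest: subseq_pair_mem)
  then show ?thesis
    unfolding Forb_pats[OF av] Forb_pats[OF avs(1)] Forb_pats[OF avs(2)] by auto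
qed

text \<open>The repeated \<open>m\<close> forbids all smaller values through 110, and
  \<open>m\<close> is forbidden because it occurs.\<close>

lemma Forb_pats_repeated_max:
  assumes "avoids_all xs pats" "set xs \<subseteq> {..m}" "subseq [m, m] xs"
  shows "Forb xs pats = {..m}"
proof
  show "Forb xs pats \<subseteq> {..m}"
    using Forb_pats_subset[of xs "Suc m"] assms(1,2) by (simp add: lessThan_Suc_atMost)
  show "{..m} \<subseteq> Forb xs pats"
    unfolding Forb_pats[OF assms(1)] using assms(3)
    by (auto dest: subseq_pair_mem simp: le_less)
qed

text \<open>A repeated value forbids everything below it, including values in the gaps of the image
  of \<open>h\<close>. The intersections discard these.\<close>

lemma Forb_pats_map:
  assumes mono: "strict_mono_on K h" and K: "set xs \<subseteq> K" and av: "avoids_all xs pats"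
  shows "Forb (map h xs) pats \<inter> h ` K = h ` (Forb xs pats \<inter> K)"
proof -
  have inj: "inj_on h K"
    using mono by (rule strict_mono_on_imp_inj_on)
  have "h u \<in> Forb (map h xs) pats \<longleftrightarrow> u \<in> Forb xs pats" if u: "u \<in> K" for u
  proof -
    have "h u \<in> set (map h xs) \<longleftrightarrow> u \<in> set xs"
      using inj_on_image_mem_iff[OF inj u K] by simp
    moreover have "(\<exists>b>h u. subseq [b, b] (map h xs)) \<longleftrightarrow> (\<exists>b>u. subseq [b, b] xs)" (is "?L \<longleftrightarrow> ?R")
    proof
      assume ?L
      then obtain b where b: "h u < b" "subseq [b, b] (map h xs)" by blast
      then have "b \<in> h ` set xs" using subseq_pair_mem(1)[OF b(2)] by simp
      then obtain c where c: "b = h c" "c \<in> set xs" by blast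
      then have "c \<in> K" using K by blast
      then have "u < c" using b(1) c(1) strict_mono_on_less[OF mono u] by simp
      moreover have "subseq [c, c] xs"
        using subseq_map_inj_on[OF inj, of "[c, c]" xs] b(2) c(1) K \<open>c \<in> K\<close> by simp
      ultimately show ?R by blast
    next
      assume ?R
      then obtain b where b: "u < b" "subseq [b, b] xs" by blast
      then have "b \<in> K" using K subseq_pair_mem(1)[OF b(2)] by blast
      then have "h u < h b" using b(1) strict_mono_on_less[OF mono u] by simp
      moreover have "subseq [h b, h b] (map h xs)" using subseq_map[OF b(2), of h] by simp
      ultimately show ?L by blast
    qed
    moreover have "avoids_all (map h xs) pats" using av avoids_pats_map[OF mono K] by blast
    ultimately show ?thesis
      unfolding Forb_pats[OF av] by (simp only: Forb_pats mem_Collect_eq)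
  qed
  then show ?thesis by blast
qed

section \<open>Counting words over an arbitrary finite alphabet\<close>

text \<open>Two predicates are used so that forbidden values can be restricted to \<open>S\<close>
  on one side only.\<close>

lemma card_words_relabel:
  assumes h: "bij_betw h K S"
    and PQ: "\<And>w. set w \<subseteq> K \<Longrightarrow> Q (map h w) \<longleftrightarrow> P w"
  shows "card {w. length w = l \<and> set w \<subseteq> S \<and> Q w} = card {w. length w = l \<and> set w \<subseteq> K \<and> P w}"
proof -
  have "bij_betw (map h) (lists K) (lists S)"
    using h by (rule bij_lists)
  then have "bij_betw (map h) {w \<in> lists K. length w = l \<and> P w} {w \<in> lists S. length w = l \<and> Q w}"
    by (rule bij_betw_Collect) (simp add: PQ lists_eq_set)
  moreover have "{w \<in> lists K. length w = l \<and> P w} = {w. length w = l \<and> set w \<subseteq> K \<and> P w}"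
    "{w \<in> lists S. length w = l \<and> Q w} = {w. length w = l \<and> set w \<subseteq> S \<and> Q w}"
    unfolding lists_eq_set by blast+
  ultimately have "bij_betw (map h) {w. length w = l \<and> set w \<subseteq> K \<and> P w}
      {w. length w = l \<and> set w \<subseteq> S \<and> Q w}"
    by simp
  then show ?thesis by (rule bij_betw_same_card[symmetric])
qed

text \<open>The increasing enumeration of \<open>S\<close> preserves relative order, hence avoidance
  and the forbidden values inside \<open>S\<close>. On the initial segment every forbidden value
  already lies in the alphabet.\<close>

lemma card_words_avoiding_relabel:
  assumes "finite S"
  shows "card {w. length w = l \<and> set w \<subseteq> S \<and> avoids_all w pats} =
      card (words_avoiding l (card S) pats)" (is ?th1)
    and "card {w. length w = l \<and> set w \<subseteq> S \<and> avoids_all w pats \<and> card (Forb w pats \<inter> S) = q} =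
      num_b l (card S) q" (is ?th2)
proof -
  obtain h where h: "bij_betw h {..<card S} S" and mono: "strict_mono_on {..<card S} h"
    using ex_bij_betw_strict_mono_card[OF assms] .
  have av: "avoids_all (map h w) pats \<longleftrightarrow> avoids_all w pats" if "set w \<subseteq> {..<card S}" for w
    using avoids_pats_map[OF mono that] .
  show ?th1
    using card_words_relabel[OF h, of "\<lambda>w. avoids_all w pats" "\<lambda>w. avoids_all w pats", OF av]
    by (simp add: words_avoiding_def atLeast0LessThan)
  have "card (Forb (map h w) pats \<inter> S) = card (Forb w pats)"
    if w: "set w \<subseteq> {..<card S}" "avoids_all w pats" for w
  proof -
    have "Forb w pats \<inter> {..<card S} = Forb w pats"
      using Forb_pats_subset[OF w(2,1)] by blast
    then have "Forb (map h w) pats \<inter> S = h ` Forb w pats"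
      using Forb_pats_map[OF mono w] h by (simp add: bij_betw_def)
    moreover have "inj_on h (Forb w pats)"
      using h Forb_pats_subset[OF w(2,1)] by (meson bij_betw_def inj_on_subset)
    ultimately show ?thesis by (simp add: card_image)
  qed
  then have "avoids_all (map h w) pats \<and> card (Forb (map h w) pats \<inter> S) = q \<longleftrightarrow>
      avoids_all w pats \<and> card (Forb w pats) = q" if "set w \<subseteq> {..<card S}" for w
    using av that by metis
  from card_words_relabel[OF h, of "\<lambda>w. avoids_all w pats \<and> card (Forb w pats \<inter> S) = q"
      "\<lambda>w. avoids_all w pats \<and> card (Forb w pats) = q", OF this]
  show ?th2
    by (simp add: num_b_def words_avoiding_def atLeast0LessThan conj_assoc)
qed

text \<open>The index -1 arising at \<open>p = n\<close> makes both sums empty.\<close>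

lemma num_c_nat:
  assumes "p \<le> n"
  shows "num_c (int n - int p - 1) k = (\<Sum>l<n - p. card (words_avoiding l k pats))"
proof -
  have "{0..int n - int p - 1} = int ` {..<n - p}"
  proof (intro set_eqI iffI)
    fix x assume "x \<in> {0..int n - int p - 1}"
    then have "x = int (nat x)" "nat x < n - p" using assms by auto
    then show "x \<in> int ` {..<n - p}" by blast
  qed (use assms in auto)
  then show ?thesis by (simp add: num_c_def sum.reindex)
qed

section \<open>Counting the parts to the right of the first maximum\<close>

text \<open>This is the bracketed factor of the recurrence. It depends on \<open>xs\<close> only
  through \<open>i\<close>, since the \<open>m - i\<close> values not forbidden by \<open>xs\<close>
  serve as an alphabet.\<close>

lemma card_completions:
  assumes av: "avoids_all xs pats" and xs: "set xs \<subseteq> {..<m}"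
    and i: "card (Forb xs pats) = i" "i < f"
  shows "card {ys. length ys = l \<and> set ys \<subseteq> {..m} \<and> avoids_all (xs @ m # ys) pats \<and>
        card (Forb (xs @ m # ys) pats) = f} =
      num_b l (m - i) (f - i - 1) +
      (if f = m + 1 then 1 else 0) * (\<Sum>k<l. card (words_avoiding k (m - i) pats))"
    (is "card ?C = _")
proof -
  \<comment> \<open>\<open>A\<close> and \<open>B\<close> collect the completions in which \<open>m\<close> does not, respectively does, recur.\<close>
  define S where "S = {..<m} - Forb xs pats"
  define W where "W k = {zs. length zs = k \<and> set zs \<subseteq> S \<and> avoids_all zs pats}" for k
  define A where "A = {ys. length ys = l \<and> set ys \<subseteq> S \<and> avoids_all ys pats \<and>
    card (Forb ys pats \<inter> S) = f - i - 1}"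
  define B where "B = (\<lambda>(k, zs). zs @ replicate (l - k) m) ` Sigma {..<l} W"
  have Fsub: "Forb xs pats \<subseteq> {..<m}" by (rule Forb_pats_subset[OF av xs])
  have finF: "finite (Forb xs pats)" using Fsub finite_subset by blast
  have finS: "finite S" and cardS: "card S = m - i"
    using Fsub finF i by (auto simp: S_def card_Diff_subset)
  have SW: "set zs \<subseteq> S \<and> avoids_all zs pats \<longleftrightarrow> avoids_all (xs @ m # zs) pats"
    if "set zs \<subseteq> {..<m}" for zs
    using avoids_pats_peak[OF xs that] av that unfolding S_def by blast
  \<comment> \<open>Of the \<open>f\<close> forbidden values, \<open>i\<close> come from
    \<open>xs\<close> and one is \<open>m\<close>, which leaves \<open>f - i - 1\<close> for
    \<open>ys\<close> inside \<open>S\<close>. The subtraction is exact because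
    \<open>i < f\<close>.\<close>
  have AC: "ys \<in> ?C \<longleftrightarrow> ys \<in> A" if ys: "set ys \<subseteq> {..<m}" for ys
  proof -
    have "card (Forb (xs @ m # ys) pats) = Suc (i + card (Forb ys pats \<inter> S))"
      if avm: "avoids_all (xs @ m # ys) pats"
    proof -
      have "avoids_all ys pats" using SW[OF ys] avm by blast
      then have sub: "Forb ys pats \<subseteq> {..<m}" by (rule Forb_pats_subset) (rule ys)
      then have "Forb (xs @ m # ys) pats = insert m (Forb xs pats \<union> (Forb ys pats \<inter> S))"
        unfolding Forb_pats_peak[OF xs ys avm] S_def by blast
      moreover have "m \<notin> Forb xs pats \<union> (Forb ys pats \<inter> S)"
        using Fsub sub by auto
      moreover have "Forb xs pats \<inter> (Forb ys pats \<inter> S) = {}" unfolding S_def by blast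
      ultimately show ?thesis
        using finF finS i by (simp add: card_Un_disjoint)
    qed
    moreover have "set ys \<subseteq> {..m}" using ys by auto
    ultimately show ?thesis
      using SW[OF ys] i unfolding A_def by auto
  qed
  \<comment> \<open>When \<open>m\<close> recurs, exactly \<open>m + 1\<close> values are forbidden
    whatever \<open>zs\<close> is, so \<open>f\<close> is determined and \<open>zs\<close> need only
    avoid the patterns over \<open>S\<close>.\<close>
  have BC: "zs @ replicate t m \<in> ?C \<longleftrightarrow> length zs + t = l \<and> zs \<in> W (length zs) \<and> f = m + 1"
    if zs: "set zs \<subseteq> {..<m}" and t: "0 < t" for zs t
  proof -
    have sub: "set (xs @ m # zs) \<subseteq> {..m}" using xs zs by auto
    have avt: "avoids_all (xs @ m # zs @ replicate t m) pats \<longleftrightarrow> avoids_all (xs @ m # zs) pats"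
      using avoids_pats_append_replicate[OF sub, of t] by simp
    have "card (Forb (xs @ m # zs @ replicate t m) pats) = m + 1"
      if "avoids_all (xs @ m # zs) pats"
    proof -
      have "set (xs @ m # zs @ replicate t m) \<subseteq> {..m}" using sub by auto
      moreover have "subseq [m, m] (xs @ m # zs @ replicate t m)"
        using t by (auto simp: subseq_pair_append subseq_singleton_left)
      ultimately show ?thesis
        using Forb_pats_repeated_max[of "xs @ m # zs @ replicate t m" m] avt that by simp
    qed
    then show ?thesis using avt SW[OF zs] zs unfolding W_def by auto
  qed
  have Ssub: "S \<subseteq> {..<m}" by (auto simp: S_def)
  have C_eq: "?C = A \<union> (if f = m + 1 then B else {})"
  proof (intro set_eqI iffI)
    fix ys assume ys: "ys \<in> ?C"
    then obtain zs t where zs: "ys = zs @ replicate t m" "set zs \<subseteq> {..<m}"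
      using avoids_pats_peak_tail by blast
    show "ys \<in> A \<union> (if f = m + 1 then B else {})"
    proof (cases "t = 0")
      case True
      then show ?thesis using AC[of ys] ys zs by simp
    next
      case False
      then have *: "length zs + t = l \<and> zs \<in> W (length zs) \<and> f = m + 1"
        using BC[OF zs(2)] ys zs(1) by simp
      then have "ys \<in> B"
        unfolding B_def using False zs(1)
        by (intro image_eqI[of _ _ "(length zs, zs)"]) auto
      with * show ?thesis by simp
    qed
  next
    fix ys assume "ys \<in> A \<union> (if f = m + 1 then B else {})"
    then consider "ys \<in> A" | "f = m + 1" "ys \<in> B" by (auto split: if_splits)
    then show "ys \<in> ?C"
    proof cases
      case 1
      then have "set ys \<subseteq> {..<m}" using Ssub unfolding A_def by blast
      then show ?thesis using AC 1 by blast
    next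
      case 2
      then obtain k zs where k: "k < l" "zs \<in> W k" "ys = zs @ replicate (l - k) m"
        unfolding B_def by auto
      then have "set zs \<subseteq> {..<m}" "length zs = k" using Ssub unfolding W_def by blast+
      then show ?thesis using BC[of zs "l - k"] k 2 by simp
    qed
  qed
  have finW: "finite (W k)" for k
    unfolding W_def by (rule finite_subset[OF _ finite_lists_length_eq[OF finS, of k]]) auto
  have "finite A"
    unfolding A_def by (rule finite_subset[OF _ finite_lists_length_eq[OF finS, of l]]) auto
  moreover have "finite B" unfolding B_def using finW by auto
  moreover have "A \<inter> B = {}"
  proof -
    have "m \<in> set ys" if "ys \<in> B" for ys using that unfolding B_def by auto
    moreover have "m \<notin> set ys" if "ys \<in> A" for ys using that Ssub unfolding A_def by auto
    ultimately show ?thesis by blast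
  qed
  moreover have "card A = num_b l (m - i) (f - i - 1)"
    unfolding A_def using card_words_avoiding_relabel(2)[OF finS] cardS by simp
  moreover have "card B = (\<Sum>k<l. card (words_avoiding k (m - i) pats))"
  proof -
    have inj: "inj_on (\<lambda>(k, zs). zs @ replicate (l - k) m) (Sigma {..<l} W)"
    proof (rule inj_onI, clarify)
      fix k zs k' zs'
      assume zs: "zs \<in> W k" "zs' \<in> W k'" and eq: "zs @ replicate (l - k) m = zs' @ replicate (l - k') m"
      \<comment> \<open>Cutting before the first \<open>m\<close> recovers the word, and its length
        recovers \<open>k\<close>.\<close>
      have "takeWhile (\<lambda>x. x \<noteq> m) (us @ replicate t m) = us" if "us \<in> W j" for us j t
      proof -
        have "m \<notin> set us" using that Ssub unfolding W_def by auto
        then have "takeWhile (\<lambda>x. x \<noteq> m) (us @ replicate t m) = us @ takeWhile (\<lambda>x. x \<noteq> m) (replicate t m)"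
          by (intro takeWhile_append2) auto
        then show ?thesis by (cases t) auto
      qed
      with zs eq have "zs = zs'" by metis
      with zs show "k = k' \<and> zs = zs'" unfolding W_def by simp
    qed
    have "card B = (\<Sum>k<l. card (W k))"
      unfolding B_def card_image[OF inj] using finW by (intro card_SigmaI) auto
    then show ?thesis
      unfolding W_def card_words_avoiding_relabel(1)[OF finS] cardS .
  qed
  ultimately show ?thesis unfolding C_eq by (simp add: card_Un_disjoint)
qed

section \<open>Maxima, inversion sequences and the recurrence\<close>

lemma max_entry_eq_iff: "max_entry xs = int m \<longleftrightarrow> m \<in> set xs \<and> set xs \<subseteq> {..m}"
proof (cases "xs = []")
  case False
  then have "Max (set xs) = m \<longleftrightarrow> m \<in> set xs \<and> (\<forall>x\<in>set xs. x \<le> m)"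
    by (intro Max_eq_iff) auto
  with False show ?thesis by (auto simp: max_entry_def)
qed (simp add: max_entry_def)

text \<open>The lower bound expresses nonemptiness, as the empty list has maximum -1.\<close>

lemma max_entry_less_iff:
  "0 \<le> max_entry xs \<and> max_entry xs < int m \<longleftrightarrow> xs \<noteq> [] \<and> set xs \<subseteq> {..<m}"
proof (cases "xs = []")
  case False
  then have "Max (set xs) < m \<longleftrightarrow> (\<forall>x\<in>set xs. x < m)" by simp
  with False show ?thesis by (auto simp: max_entry_def simp del: Max_less_iff)
qed (simp add: max_entry_def)

text \<open>The bound on entries only weakens along the sequence, so once \<open>m\<close> fits at
  its own position, later entries up to \<open>m\<close> fit too. With
  \<open>p = length xs + 1\<close> this is the range \<open>m + 1 \<le> p\<close>.\<close>

lemma inversion_seq_peak: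
  assumes "set ys \<subseteq> {..m}"
  shows "inversion_seq (xs @ m # ys) \<longleftrightarrow> inversion_seq xs \<and> m \<le> length xs"
proof
  assume *: "inversion_seq (xs @ m # ys)"
  then have le: "(xs @ m # ys) ! i < i + 1" if "i \<le> length xs" for i
    using that unfolding inversion_seq_def by simp
  have "xs ! i < i + 1" if "i < length xs" for i
    using le[of i] that by (simp add: nth_append)
  with le[of "length xs"] show "inversion_seq xs \<and> m \<le> length xs"
    unfolding inversion_seq_def by simp
next
  assume *: "inversion_seq xs \<and> m \<le> length xs"
  show "inversion_seq (xs @ m # ys)"
    unfolding inversion_seq_def
  proof (intro allI impI)
    fix i assume i: "i < length (xs @ m # ys)"
    show "(xs @ m # ys) ! i < i + 1"
    proof (cases "i < length xs")
      case True
      with * show ?thesis unfolding inversion_seq_def by (simp add: nth_append)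
    next
      case False
      then have "(xs @ m # ys) ! i \<in> set (m # ys)"
        using i by (simp only: nth_append if_False) (rule nth_mem, simp)
      then have "(xs @ m # ys) ! i \<le> m" using assms by auto
      with False * show ?thesis by simp
    qed
  qed
qed

lemma finite_inv_seqs_avoiding: "finite (inv_seqs_avoiding n P)"
proof (rule finite_subset)
  show "inv_seqs_avoiding n P \<subseteq> {xs. set xs \<subseteq> {..<n} \<and> length xs = n}"
    unfolding inv_seqs_avoiding_def inversion_seq_def
    by (force simp: in_set_conv_nth)
qed (simp add: finite_lists_length_eq)

theorem theorem21:
  fixes n m f :: nat
  assumes "2 \<le> f" and "f \<le> m + 1" and "m + 1 \<le> n"
  shows "num_a n m f =
    (\<Sum>p\<in>{m + 1..n}. \<Sum>i\<in>{0..f - 1}. \<Sum>j\<in>{0..m - 1}.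
       num_a (p - 1) j i *
       (num_b (n - p) (m - i) (f - i - 1)
        + (if f = m + 1 then 1 else 0) * num_c (int n - int p - 1) (m - i)))"
proof -
  \<comment> \<open>\<open>p\<close> is the position of the first maximum, counted from one.
    \<open>X p\<close> holds the possible left parts, \<open>C p xs\<close> the right parts
    completing \<open>xs\<close>, and \<open>G p i\<close> the claimed number of these.\<close>
  define X where "X p = {xs \<in> inv_seqs_avoiding (p - 1) pats.
      0 \<le> max_entry xs \<and> max_entry xs < int m \<and> card (Forb xs pats) < f}" for p
  define C where "C p xs = {ys. length ys = n - p \<and> set ys \<subseteq> {..m} \<and>
      avoids_all (xs @ m # ys) pats \<and> card (Forb (xs @ m # ys) pats) = f}" for p xs
  define G where "G p i = num_b (n - p) (m - i) (f - i - 1)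
        + (if f = m + 1 then 1 else 0) * num_c (int n - int p - 1) (m - i)" for p i
  let ?D = "SIGMA p:{m + 1..n}. SIGMA xs:X p. C p xs"
  let ?g = "\<lambda>(p, xs, ys). xs @ m # ys"
  let ?A = "{\<sigma> \<in> inv_seqs_avoiding n pats. max_entry \<sigma> = int m \<and> card (Forb \<sigma> pats) = f}"
  have X: "length xs = p - 1" "inversion_seq xs" "avoids_all xs pats" "xs \<noteq> []"
    "set xs \<subseteq> {..<m}" "card (Forb xs pats) < f" if "xs \<in> X p" for xs p
    using that max_entry_less_iff[of xs m] unfolding X_def inv_seqs_avoiding_def by auto
  have inj: "inj_on ?g ?D"
  proof (rule inj_onI)
    fix t t' assume t: "t \<in> ?D" "t' \<in> ?D" and g: "?g t = ?g t'"
    obtain p xs ys p' xs' ys' where tt: "t = (p, xs, ys)" "t' = (p', xs', ys')"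
      by (metis prod.exhaust)
    have p: "m + 1 \<le> p" "m + 1 \<le> p'" and xs: "xs \<in> X p" "xs' \<in> X p'"
      using t unfolding tt by auto
    have eq: "xs @ m # ys = xs' @ m # ys'" using g unfolding tt by simp
    \<comment> \<open>The part before the first \<open>m\<close> is \<open>xs\<close>, and its
      length \<open>p - 1\<close> determines \<open>p\<close> because \<open>p\<close> is
      positive.\<close>
    have tw: "takeWhile (\<lambda>x. x \<noteq> m) (us @ m # vs) = us" if "us \<in> X q" for us vs q
      using X(5)[OF that] by (auto simp: takeWhile_append)
    have "xs = xs'" using tw[OF xs(1), of ys] tw[OF xs(2), of ys'] eq by simp
    moreover from this eq have "ys = ys'" by simp
    moreover have "p = p'" using X(1)[OF xs(1)] X(1)[OF xs(2)] p \<open>xs = xs'\<close> by simp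
    ultimately show "t = t'" unfolding tt by simp
  qed
  have image: "?g ` ?D = ?A"
  proof (intro set_eqI iffI)
    fix \<sigma> assume "\<sigma> \<in> ?g ` ?D"
    then obtain p xs ys where p: "m + 1 \<le> p" "p \<le> n" and xs: "xs \<in> X p" and ys: "ys \<in> C p xs"
      and \<sigma>: "\<sigma> = xs @ m # ys" by auto
    have "length \<sigma> = n" using X(1)[OF xs] ys p unfolding C_def \<sigma> by auto
    moreover have "inversion_seq \<sigma>"
      using inversion_seq_peak[of ys m xs] X(1,2)[OF xs] ys p unfolding C_def \<sigma> by auto
    moreover have "max_entry \<sigma> = int m"
      using X(5)[OF xs] ys unfolding max_entry_eq_iff C_def \<sigma> by auto
    ultimately show "\<sigma> \<in> ?A"
      using ys unfolding C_def \<sigma> inv_seqs_avoiding_def by simp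
  next
    fix \<sigma> assume "\<sigma> \<in> ?A"
    then have len: "length \<sigma> = n" and inv: "inversion_seq \<sigma>" and av: "avoids_all \<sigma> pats"
      and f: "card (Forb \<sigma> pats) = f" and max: "m \<in> set \<sigma>" "set \<sigma> \<subseteq> {..m}"
      unfolding inv_seqs_avoiding_def max_entry_eq_iff by auto
    obtain xs ys where \<sigma>: "\<sigma> = xs @ m # ys" and m: "m \<notin> set xs"
      using split_list_first[OF max(1)] by blast
    have xs: "set xs \<subseteq> {..<m}"
      using max(2) m unfolding \<sigma> by (auto simp: le_less)
    have ys: "set ys \<subseteq> {..m}" using max(2) unfolding \<sigma> by auto
    have xs_inv: "inversion_seq xs" "m \<le> length xs"
      using inv inversion_seq_peak[OF ys] unfolding \<sigma> by auto
    have xs_av: "avoids_all xs pats" using av unfolding \<sigma> by (rule avoids_pats_prefix)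
    \<comment> \<open>The bounds on \<open>f\<close> give \<open>1 \<le> m\<close>, so a prefix of
      length at least \<open>m\<close> is nonempty.\<close>
    have "xs \<noteq> []" using xs_inv(2) assms by auto
    \<comment> \<open>Everything forbidden by \<open>xs\<close> stays forbidden, and
      \<open>m\<close> is forbidden by \<sigma> but not by \<open>xs\<close>, so the inclusion is
      strict.\<close>
    moreover have "card (Forb xs pats) < f"
    proof -
      have "Forb \<sigma> pats \<subseteq> {..<Suc m}"
        using Forb_pats_subset[OF av, of "Suc m"] max(2) by (simp add: lessThan_Suc_atMost)
      then have "finite (Forb \<sigma> pats)" using finite_subset by blast
      moreover have "subseq [b, b] \<sigma>" if "subseq [b, b] xs" for b
        using that unfolding \<sigma> by (rule subseq_rev_drop_many)
      then have "Forb xs pats \<subseteq> Forb \<sigma> pats"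
        unfolding Forb_pats[OF xs_av] Forb_pats[OF av] using \<sigma> by auto
      moreover have "m \<in> Forb \<sigma> pats"
        unfolding Forb_pats[OF av] using max(1) by simp
      moreover have "m \<notin> Forb xs pats" using Forb_pats_subset[OF xs_av xs] by blast
      ultimately show ?thesis using f psubset_card_mono by blast
    qed
    ultimately have "xs \<in> X (length xs + 1)"
      using max_entry_less_iff[of xs m] xs xs_inv xs_av unfolding X_def inv_seqs_avoiding_def by simp
    moreover have "ys \<in> C (length xs + 1) xs"
      using len ys av f unfolding C_def \<sigma> by auto
    moreover have "length xs + 1 \<in> {m + 1..n}" using len xs_inv(2) unfolding \<sigma> by auto
    ultimately show "\<sigma> \<in> ?g ` ?D"
      unfolding \<sigma> by (intro image_eqI[of _ _ "(length xs + 1, xs, ys)"]) auto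
  qed
  have finX: "finite (X p)" for p
    unfolding X_def using finite_inv_seqs_avoiding by simp
  have finC: "finite (C p xs)" for p xs
    unfolding C_def by (rule finite_subset[OF _ finite_lists_length_eq[of "{..m}" "n - p"]]) auto
  have "num_a n m f = card ?D"
    unfolding num_a_def image[symmetric] by (rule card_image[OF inj])
  also have "\<dots> = (\<Sum>p\<in>{m + 1..n}. \<Sum>xs\<in>X p. card (C p xs))"
    using finX finC by (simp add: card_SigmaI)
  also have "\<dots> = (\<Sum>p\<in>{m + 1..n}. \<Sum>i\<in>{0..f - 1}. \<Sum>j\<in>{0..m - 1}. num_a (p - 1) j i * G p i)"
  proof (rule sum.cong[OF refl])
    fix p assume p: "p \<in> {m + 1..n}"
    let ?T = "{0..f - 1} \<times> {0..m - 1}"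
    \<comment> \<open>The left parts are grouped by the pair of summation indices
      \<open>(i, j)\<close>. Maxima on \<open>X p\<close> are nonnegative, so \<open>nat\<close>
      loses nothing.\<close>
    let ?k = "\<lambda>xs. (card (Forb xs pats), nat (max_entry xs))"
    have "card (C p xs) = G p (card (Forb xs pats))" if "xs \<in> X p" for xs
      using card_completions[OF X(3,5)[OF that] refl X(6)[OF that], of "n - p"] p
      unfolding C_def G_def by (simp add: num_c_nat)
    then have "(\<Sum>xs\<in>X p. card (C p xs)) = (\<Sum>xs\<in>X p. G p (card (Forb xs pats)))"
      by (rule sum.cong[OF refl])
    also have "\<dots> = (\<Sum>t\<in>?T. \<Sum>xs\<in>{xs \<in> X p. ?k xs = t}. G p (card (Forb xs pats)))"
    proof -
      have "?k ` X p \<subseteq> ?T" unfolding X_def by auto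
      from sum.group[OF finX _ this, of "\<lambda>xs. G p (card (Forb xs pats))"]
      show ?thesis by simp
    qed
    also have "\<dots> = (\<Sum>(i, j)\<in>?T. num_a (p - 1) j i * G p i)"
    proof (rule sum.cong[OF refl], clarify)
      fix i j assume "i \<in> {0..f - 1}" "j \<in> {0..m - 1}"
      \<comment> \<open>Both \<open>f\<close> and \<open>m\<close> are positive, so the truncated
        upper bounds \<open>f - 1\<close> and \<open>m - 1\<close> give strict inequalities.\<close>
      then have ij: "i < f" "j < m" using assms by auto
      have "{xs \<in> X p. ?k xs = (i, j)} =
          {xs \<in> inv_seqs_avoiding (p - 1) pats. max_entry xs = int j \<and> card (Forb xs pats) = i}"
        unfolding X_def using ij by auto
      moreover have "(\<Sum>xs\<in>{xs \<in> X p. ?k xs = (i, j)}. G p (card (Forb xs pats))) =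
          (\<Sum>xs\<in>{xs \<in> X p. ?k xs = (i, j)}. G p i)"
        by (rule sum.cong[OF refl]) simp
      ultimately show "(\<Sum>xs\<in>{xs \<in> X p. ?k xs = (i, j)}. G p (card (Forb xs pats))) =
          num_a (p - 1) j i * G p i"
        unfolding num_a_def by simp
    qed
    also have "\<dots> = (\<Sum>i\<in>{0..f - 1}. \<Sum>j\<in>{0..m - 1}. num_a (p - 1) j i * G p i)"
      by (rule sum.cartesian_product[symmetric])
    finally show "(\<Sum>xs\<in>X p. card (C p xs)) =
      (\<Sum>i\<in>{0..f - 1}. \<Sum>j\<in>{0..m - 1}. num_a (p - 1) j i * G p i)" .
  qed
  finally show ?thesis unfolding G_def .
qed

end
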